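(* Neither the uniformity measure $I_U$ nor the directed coverage measure $I_{DC}$ is outlier consistent.
   Context: For $x,y\in\mathbb{R}^d$, $y$ dominates $x$ if $x_i\le y_i$ for all $i\in[d]$ and $x_j<y_j$ for some $j\in[d]$. A set of alternatives is a finite set $A\subseteq\mathbb{R}^d$ ($d\ge 1$ arbitrary) none of whose elements is dominated by another element of $A$. Let $\|x-y\|=\sum_{i=1}^d|x_i-y_i|$ and $\|x-y\|_+=\sum_{i=1}^d\max(x_i-y_i,0)$. For nonempty $S\subseteq A$, $I_U(S)=\min_{x,y\in S,\,x\neq y}\|x-y\|$ ($+\infty$ if $|S|=1$; higher is better) and $I_{DC}(S,A)=\max_{a\in A}\min_{s\in S}\|a-s\|_+$ (lower is better). For a positive integer $k$, $\mathcal{S}(I,A,k)$ is the set of all $S\subseteq A$ with $|S|=k$ that are optimal for $I$ among the size-$k$ subsets of $A$ (maximizing $I_U$, respectively minimizing $I_{DC}(\cdot,A)$). An alternative $x\in A$ is an outlier alternative if $\min_{a\in A\setminus\{x\}}\|x-a\|>\max_{y,z\in A\setminus\{x\}}\|y-z\|$. A measure $I$ is outlier consistent if for any $k\ge 2$ and any set of alternatives $A$ containing an outlier alternative $x\in A$, we have $x\in S$ for each $S\in\mathcal{S}(I,A,k)$. *)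

theory Defs
  imports "Jordan_Normal_Form.Matrix" "HOL-Library.Extended_Real"
begin

(* Since d is quantified inside the notion of outlier consistency, the points of R^d are
   modelled as carrier_vec d rather than by a type-indexed dimension. *)

definition dominates :: "nat \<Rightarrow> real vec \<Rightarrow> real vec \<Rightarrow> bool" where
  "dominates d y x \<longleftrightarrow> (\<forall>i<d. x $ i \<le> y $ i) \<and> (\<exists>j<d. x $ j < y $ j)"

definition alternatives :: "nat \<Rightarrow> real vec set \<Rightarrow> bool" where
  "alternatives d A \<longleftrightarrow>
     d \<ge> 1 \<and> finite A \<and> A \<subseteq> carrier_vec d \<and> (\<forall>x\<in>A. \<forall>y\<in>A. \<not> dominates d y x)"

definition dist1 :: "real vec \<Rightarrow> real vec \<Rightarrow> real" where
  "dist1 x y = (\<Sum>i<dim_vec x. \<bar>x $ i - y $ i\<bar>)"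

definition dist1_pos :: "real vec \<Rightarrow> real vec \<Rightarrow> real" where
  "dist1_pos x y = (\<Sum>i<dim_vec x. max (x $ i - y $ i) 0)"

(* A measure I, given as a function of S and A, together with its direction of optimization. *)
datatype quality_measure =
    Higher_Better "real vec set \<Rightarrow> real vec set \<Rightarrow> ereal"
  | Lower_Better "real vec set \<Rightarrow> real vec set \<Rightarrow> ereal"

fun at_least_as_good :: "quality_measure \<Rightarrow> real vec set \<Rightarrow> real vec set \<Rightarrow> real vec set \<Rightarrow> bool" where
  "at_least_as_good (Higher_Better I) A S T \<longleftrightarrow> I S A \<ge> I T A"
| "at_least_as_good (Lower_Better I) A S T \<longleftrightarrow> I S A \<le> I T A"

definition optimal_subsets :: "quality_measure \<Rightarrow> real vec set \<Rightarrow> nat \<Rightarrow> real vec set set" where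
  "optimal_subsets I A k =
     {S. S \<subseteq> A \<and> card S = k \<and> (\<forall>T. T \<subseteq> A \<and> card T = k \<longrightarrow> at_least_as_good I A S T)}"

definition uniformity :: "real vec set \<Rightarrow> ereal" where
  "uniformity S =
     (if card S = 1 then \<infinity>
      else ereal (Min {dist1 x y | x y. x \<in> S \<and> y \<in> S \<and> x \<noteq> y}))"

definition directed_coverage :: "real vec set \<Rightarrow> real vec set \<Rightarrow> real" where
  "directed_coverage S A = Max ((\<lambda>a. Min ((\<lambda>s. dist1_pos a s) ` S)) ` A)"

definition I_U :: quality_measure where
  "I_U = Higher_Better (\<lambda>S A. uniformity S)"

definition I_DC :: quality_measure where
  "I_DC = Lower_Better (\<lambda>S A. ereal (directed_coverage S A))"

(* A - {x} must be nonempty for the minimum and the maximum to exist. This does not affect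
   outlier consistency: a singleton A has no subsets of size k >= 2. *)
definition outlier :: "real vec set \<Rightarrow> real vec \<Rightarrow> bool" where
  "outlier A x \<longleftrightarrow> x \<in> A \<and> A - {x} \<noteq> {} \<and>
     Min {dist1 x a | a. a \<in> A - {x}} > Max {dist1 y z | y z. y \<in> A - {x} \<and> z \<in> A - {x}}"

definition outlier_consistent :: "quality_measure \<Rightarrow> bool" where
  "outlier_consistent I \<longleftrightarrow>
     (\<forall>k\<ge>2. \<forall>d A x. alternatives d A \<and> outlier A x \<longrightarrow> (\<forall>S \<in> optimal_subsets I A k. x \<in> S))"

end

theory Submission
  imports Defs
begin

text \<open>
  Both measures fail on the three unit vectors of \<open>\<real>\<^sup>3\<close> together with the outlier \<open>(2, -3, 0)\<close>,
  with \<open>k = 3\<close>. The unit vectors are pairwise at distance 2, and every three-element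
  subset contains two of them, so none has uniformity above 2. The outlier exceeds the first
  unit vector by only 1 in the directed distance, so the unit vectors cover it within 1;
  a three-element subset that misses a unit vector leaves that vector at directed distance at least 1.
\<close>

definition point3 :: "real \<Rightarrow> real \<Rightarrow> real \<Rightarrow> real vec" where
  "point3 a b c = vec_of_list [a, b, c]"

lemma point3_carrier: "point3 a b c \<in> carrier_vec 3"
  by (rule carrier_vecI) (simp add: point3_def)

lemma point3_eq_iff: "point3 a b c = point3 a' b' c' \<longleftrightarrow> a = a' \<and> b = b' \<and> c = c'"
  by (simp add: point3_def)

lemma dist1_point3:
  "dist1 (point3 a b c) (point3 a' b' c') = \<bar>a - a'\<bar> + \<bar>b - b'\<bar> + \<bar>c - c'\<bar>"
  by (simp add: point3_def dist1_def numeral_3_eq_3)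

lemma dist1_pos_point3:
  "dist1_pos (point3 a b c) (point3 a' b' c') = max (a - a') 0 + max (b - b') 0 + max (c - c') 0"
  by (simp add: point3_def dist1_pos_def numeral_3_eq_3)

lemma dominates_point3:
  "dominates 3 (point3 a' b' c') (point3 a b c) \<longleftrightarrow>
    a \<le> a' \<and> b \<le> b' \<and> c \<le> c' \<and> (a < a' \<or> b < b' \<or> c < c')"
  by (auto simp: point3_def dominates_def numeral_3_eq_3 less_Suc_eq)

definition unit_points :: "real vec set" where
  "unit_points = {point3 1 0 0, point3 0 1 0, point3 0 0 1}"

text \<open>The entry -3 pushes the point away from the unit vectors without adding to its directed
  distance to them, since only positive excess counts there. The entry 2 exceeds the 1 of
  \<open>point3 1 0 0\<close>, so that vector does not dominate it.\<close>

definition outlying_point :: "real vec" where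
  "outlying_point = point3 2 (-3) 0"

lemma finite_unit_points: "finite unit_points"
  by (simp add: unit_points_def)

lemma card_unit_points: "card unit_points = 3"
  by (simp add: unit_points_def point3_eq_iff)

lemma outlying_point_notin: "outlying_point \<notin> unit_points"
  by (simp add: unit_points_def outlying_point_def point3_eq_iff)

lemma dist1_unit_points:
  "u \<in> unit_points \<Longrightarrow> v \<in> unit_points \<Longrightarrow> dist1 u v = (if u = v then 0 else 2)"
  by (auto simp: unit_points_def dist1_point3 point3_eq_iff)

lemma dist1_outlying_point: "u \<in> unit_points \<Longrightarrow> dist1 outlying_point u \<ge> 4"
  by (auto simp: unit_points_def outlying_point_def dist1_point3)

text \<open>A different unit vector has 0 where \<open>u\<close> has 1; against the outlier, the
  second coordinate alone contributes at least 3.\<close>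

lemma dist1_pos_from_unit_point:
  "u \<in> unit_points \<Longrightarrow> v \<in> insert outlying_point unit_points \<Longrightarrow> u \<noteq> v \<Longrightarrow> dist1_pos u v \<ge> 1"
  by (auto simp: unit_points_def outlying_point_def dist1_pos_point3)

lemma unit_point_covers:
  "v \<in> insert outlying_point unit_points \<Longrightarrow> \<exists>u\<in>unit_points. dist1_pos v u \<le> 1"
  by (auto simp: unit_points_def outlying_point_def dist1_pos_point3)

lemma alternatives_witness: "alternatives 3 (insert outlying_point unit_points)"
  by (auto simp: alternatives_def unit_points_def outlying_point_def dominates_point3
      point3_carrier)

text \<open>Discharges the finiteness conditions for \<open>Min\<close> and \<open>Max\<close> over
  sets of pairwise distances; \<open>P\<close> allows both all pairs and only distinct ones.\<close>

lemma finite_setcompr_pairs: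
  assumes "finite S"
  shows "finite {f x y | x y. x \<in> S \<and> y \<in> S \<and> P x y}"
  by (rule finite_subset[of _ "(\<lambda>(x, y). f x y) ` (S \<times> S)"]) (use assms in auto)

text \<open>The strict inequality follows from the gap between 2, the diameter of the unit vectors,
  and 4, a lower bound on the outlier's distance to them.\<close>

lemma outlier_witness: "outlier (insert outlying_point unit_points) outlying_point"
proof -
  have A: "insert outlying_point unit_points - {outlying_point} = unit_points"
    using outlying_point_notin by auto
  have ne: "unit_points \<noteq> {}"
    by (simp add: unit_points_def)
  have "Max {dist1 y z | y z. y \<in> unit_points \<and> z \<in> unit_points} \<le> 2"
  proof (rule Max.boundedI)
    show "finite {dist1 y z | y z. y \<in> unit_points \<and> z \<in> unit_points}"
      using finite_setcompr_pairs[OF finite_unit_points, of dist1 "\<lambda>_ _. True"] by simp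
    show "{dist1 y z | y z. y \<in> unit_points \<and> z \<in> unit_points} \<noteq> {}"
      using ne by blast
  qed (auto simp: dist1_unit_points)
  moreover have "4 \<le> Min {dist1 outlying_point a | a. a \<in> unit_points}"
    using finite_unit_points ne dist1_outlying_point
    by (subst Min_ge_iff) auto
  ultimately show ?thesis
    unfolding outlier_def A using ne by auto
qed

lemma uniformity_unit_points: "uniformity unit_points = 2"
proof -
  have "point3 1 0 0 \<in> unit_points" "point3 0 1 0 \<in> unit_points" "point3 1 0 0 \<noteq> point3 0 1 0"
    by (simp_all add: unit_points_def point3_eq_iff)
  then obtain u v where uv: "u \<in> unit_points" "v \<in> unit_points" "u \<noteq> v"
    by blast
  then have "dist1 u v = 2"
    by (simp add: dist1_unit_points)
  then have "2 \<in> {dist1 x y | x y. x \<in> unit_points \<and> y \<in> unit_points \<and> x \<noteq> y}"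
    using uv by (metis (mono_tags, lifting) mem_Collect_eq)
  moreover have "{dist1 x y | x y. x \<in> unit_points \<and> y \<in> unit_points \<and> x \<noteq> y} \<subseteq> {2}"
    by (auto simp: dist1_unit_points)
  ultimately have "{dist1 x y | x y. x \<in> unit_points \<and> y \<in> unit_points \<and> x \<noteq> y} = {2}"
    by blast
  then show ?thesis
    by (simp add: uniformity_def card_unit_points)
qed

lemma uniformity_witness_le:
  assumes T: "T \<subseteq> insert outlying_point unit_points" "card T = 3"
  shows "uniformity T \<le> 2"
proof -
  have fin: "finite T"
    using T(2) by (simp add: card_ge_0_finite)
  \<comment> \<open>Removing one point from three leaves two unit vectors, whose distance bounds the
    minimum.\<close>
  have "card (T - {outlying_point}) \<ge> 2"
    using T(2) diff_card_le_card_Diff[of "{outlying_point}" T] by simp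
  then obtain V where "V \<subseteq> T - {outlying_point}" "card V = 2"
    by (meson obtain_subset_with_card_n)
  then obtain u v where uv: "u \<in> T - {outlying_point}" "v \<in> T - {outlying_point}" "u \<noteq> v"
    by (auto simp: card_2_iff)
  then have "u \<in> unit_points" "v \<in> unit_points"
    using T(1) by auto
  then have "dist1 u v = 2"
    using dist1_unit_points \<open>u \<noteq> v\<close> by simp
  then have "Min {dist1 x y | x y. x \<in> T \<and> y \<in> T \<and> x \<noteq> y} \<le> 2"
    using uv by (intro Min_le finite_setcompr_pairs[OF fin])
      (metis (mono_tags, lifting) DiffD1 mem_Collect_eq)
  then show ?thesis
    using T(2) by (simp add: uniformity_def)
qed

lemma directed_coverage_unit_points:
  "directed_coverage unit_points (insert outlying_point unit_points) \<le> 1"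
  unfolding directed_coverage_def
proof (rule Max.boundedI)
  have "Min (dist1_pos v ` unit_points) \<le> 1" if v: "v \<in> insert outlying_point unit_points" for v
  proof -
    obtain u where "u \<in> unit_points" "dist1_pos v u \<le> 1"
      using unit_point_covers[OF v] by blast
    moreover from this have "Min (dist1_pos v ` unit_points) \<le> dist1_pos v u"
      by (intro Min_le finite_imageI finite_unit_points imageI)
    ultimately show ?thesis
      by linarith
  qed
  then show "c \<le> 1"
    if "c \<in> (\<lambda>a. Min (dist1_pos a ` unit_points)) ` insert outlying_point unit_points" for c
    using that by blast
qed (use finite_unit_points in auto)

lemma directed_coverage_witness_ge:
  assumes T: "T \<subseteq> insert outlying_point unit_points" "card T = 3" "T \<noteq> unit_points"
  shows "directed_coverage T (insert outlying_point unit_points) \<ge> 1"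
proof -
  have fin: "finite T" and ne: "T \<noteq> {}"
    using T(2) by (auto simp: card_ge_0_finite)
  \<comment> \<open>Both sets have three elements, so inclusion would force equality.\<close>
  have "\<not> unit_points \<subseteq> T"
    using T card_unit_points fin card_subset_eq by metis
  then obtain u where u: "u \<in> unit_points" "u \<notin> T"
    by auto
  then have "1 \<le> Min (dist1_pos u ` T)"
    using fin ne T(1) dist1_pos_from_unit_point
    by (subst Min_ge_iff) auto
  also have "\<dots> \<le> directed_coverage T (insert outlying_point unit_points)"
    unfolding directed_coverage_def
    using u finite_unit_points by (intro Max_ge) auto
  finally show ?thesis .
qed

text \<open>Reduces both halves of the theorem to the optimality of \<open>unit_points\<close>. Ties
  are harmless: consistency requires the outlier in every optimal set, so one optimal set without it
  is a counterexample.\<close>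

lemma not_outlier_consistent:
  assumes "unit_points \<in> optimal_subsets I (insert outlying_point unit_points) 3"
  shows "\<not> outlier_consistent I"
proof
  assume "outlier_consistent I"
  moreover have "(2::nat) \<le> 3"
    by simp
  ultimately have "outlying_point \<in> unit_points"
    unfolding outlier_consistent_def
    using assms alternatives_witness outlier_witness by blast
  then show False
    using outlying_point_notin by simp
qed

theorem proposition22:
  "\<not> outlier_consistent I_U \<and> \<not> outlier_consistent I_DC"
proof
  show "\<not> outlier_consistent I_U"
    by (rule not_outlier_consistent)
      (use uniformity_witness_le in
        \<open>auto simp: optimal_subsets_def I_U_def card_unit_points uniformity_unit_points\<close>)
  have "directed_coverage unit_points (insert outlying_point unit_points)
      \<le> directed_coverage T (insert outlying_point unit_points)"
    if "T \<subseteq> insert outlying_point unit_points" "card T = 3" for T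
    \<comment> \<open>The value 1 separates the two coverages when \<open>T\<close> differs from
      \<open>unit_points\<close>; otherwise they are equal.\<close>
    using order_trans[OF directed_coverage_unit_points directed_coverage_witness_ge[OF that]]
    by (cases "T = unit_points") simp_all
  then show "\<not> outlier_consistent I_DC"
    by (intro not_outlier_consistent)
      (auto simp: optimal_subsets_def I_DC_def card_unit_points)
qed

end
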